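(* Let $\mathbf{k}$ be a field and let $B$ be the commutative polynomial algebra in $|\mathbb{N}|$ (countably infinitely many) variables over $\mathbf{k}$. (a) There exists an infinite subset $\Delta$ of $\mathrm{Der}_{\mathbf{k}}(B)$ such that $\Delta$ is not a locally nilpotent subset of $\mathrm{Der}_{\mathbf{k}}(B)$, but every finite subset of $\Delta$ is a locally nilpotent subset of $\mathrm{Der}_{\mathbf{k}}(B)$. (b) For each integer $m\ge2$, there exists a subset $\Delta$ of $\mathrm{Der}_{\mathbf{k}}(B)$ with exactly $m$ elements such that $\Delta$ is not a locally nilpotent subset of $\mathrm{Der}_{\mathbf{k}}(B)$, but every proper subset of $\Delta$ is a locally nilpotent subset of $\mathrm{Der}_{\mathbf{k}}(B)$.
   Context: $\mathrm{Der}_{\mathbf{k}}(B)$ is the set of all $\mathbf{k}$-derivations $B\to B$. A subset $\Delta$ of $\mathrm{Der}_{\mathbf{k}}(B)$ is locally nilpotent if for every $x\in B$ and every infinite sequence $(F_0,F_1,\dots)$ of elements of $\Delta$ there exists $n\in\mathbb{N}$ with $(F_n\circ\cdots\circ F_0)(x)=0$ (the empty set is locally nilpotent). *)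

theory Defs
  imports "HOL-Library.Poly_Mapping" "HOL.Vector_Spaces"
begin

text \<open>
  The polynomial algebra in the variables \<open>X\<^sub>0, X\<^sub>1, \<dots>\<close> over the field \<open>'k\<close>: a monomial is a
  finitely supported exponent function on \<open>nat\<close>, and a polynomial is a finitely supported
  coefficient function on monomials. The library's ring structure on finitely supported functions
  is the convolution product, that is, multiplication of polynomials.
\<close>

type_synonym 'k inf_poly = "(nat \<Rightarrow>\<^sub>0 nat) \<Rightarrow>\<^sub>0 'k"

text \<open>Scalars act through the constant polynomials \<open>Poly_Mapping.single 0 c\<close>.\<close>

definition inf_poly_scale :: "'k::field \<Rightarrow> 'k inf_poly \<Rightarrow> 'k inf_poly" where
  "inf_poly_scale c f = Poly_Mapping.single 0 c * f"

lemma vector_space_inf_poly_scale: "vector_space inf_poly_scale"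
  by unfold_locales
    (simp_all add: inf_poly_scale_def algebra_simps single_add mult_single
      flip: mult.assoc single_one)

definition derivations :: "('k::field \<Rightarrow> 'b \<Rightarrow> 'b) \<Rightarrow> ('b::comm_ring_1 \<Rightarrow> 'b) set" where
  "derivations scale =
     {D. Vector_Spaces.linear scale scale D \<and> (\<forall>f g. D (f * g) = D f * g + f * D g)}"

text \<open>\<open>comp_upto F n\<close> is \<open>F n \<circ> \<dots> \<circ> F 0\<close>, with \<open>n + 1\<close> factors.\<close>

primrec comp_upto :: "(nat \<Rightarrow> 'b \<Rightarrow> 'b) \<Rightarrow> nat \<Rightarrow> 'b \<Rightarrow> 'b" where
  "comp_upto F 0 = F 0"
| "comp_upto F (Suc n) = F (Suc n) \<circ> comp_upto F n"

definition locally_nilpotent :: "('b::zero \<Rightarrow> 'b) set \<Rightarrow> bool" where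
  "locally_nilpotent \<Delta> \<longleftrightarrow>
     (\<forall>x. \<forall>F :: nat \<Rightarrow> 'b \<Rightarrow> 'b. (\<forall>i. F i \<in> \<Delta>) \<longrightarrow> (\<exists>n. comp_upto F n x = 0))"

end

theory Submission
  imports Defs
begin

text \<open>
  For \<open>S \<subseteq> \<nat>\<close> let \<open>D\<^sub>S = \<Sum>\<^sub>i\<^sub>\<in>\<^sub>S X\<^bsub>i+1\<^esub> \<partial>/\<partial>X\<^sub>i\<close>. A family of such derivations sending \<open>X\<^sub>0 \<mapsto> X\<^sub>1 \<mapsto> X\<^sub>2 \<mapsto> \<dots>\<close>
  is not locally nilpotent, but it is as soon as the variables carry weights \<open>w i \<in> \<nat>\<close> with
  \<open>w (i + 1) < w i\<close> whenever \<open>i\<close> lies in one of the sets \<open>S\<close>, since then every member of the family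
  strictly lowers the weight of monomials. For (a) take the singletons \<open>S = {n}\<close>, for (b) the residue
  classes modulo \<open>m\<close>; if the class of \<open>j\<close> is missing, the distance from \<open>i\<close> to the next element of
  that class is a suitable weight.
\<close>

section \<open>The derivations and their Leibniz rule\<close>

definition shift_monom :: "nat \<Rightarrow> (nat \<Rightarrow>\<^sub>0 nat) \<Rightarrow> (nat \<Rightarrow>\<^sub>0 nat)" where
  "shift_monom i a = a - Poly_Mapping.single i 1 + Poly_Mapping.single (Suc i) 1"

text \<open>Only variables occurring in \<open>a\<close> contribute, so the sum is finite even for
  infinite \<open>S\<close>, and the truncated subtraction in \<open>shift_monom\<close> is a
  genuine one there.\<close>

definition shift_der_monom :: "nat set \<Rightarrow> (nat \<Rightarrow>\<^sub>0 nat) \<Rightarrow> 'k::field inf_poly" where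
  "shift_der_monom S a =
     (\<Sum>i\<in>Poly_Mapping.keys a \<inter> S.
        Poly_Mapping.single (shift_monom i a) (of_nat (Poly_Mapping.lookup a i)))"

definition shift_der :: "nat set \<Rightarrow> 'k::field inf_poly \<Rightarrow> 'k inf_poly" where
  "shift_der S f =
     (\<Sum>a\<in>Poly_Mapping.keys f.
        Poly_Mapping.single 0 (Poly_Mapping.lookup f a) * shift_der_monom S a)"

text \<open>The added terms have coefficient zero. This lets sums over different supports, such as
  those of \<open>a\<close>, \<open>b\<close> and \<open>a + b\<close>, be compared over one index
  set.\<close>

lemma shift_der_monom_superset:
  assumes "finite K" "Poly_Mapping.keys a \<subseteq> K"
  shows "shift_der_monom S a =
     (\<Sum>i\<in>K \<inter> S. Poly_Mapping.single (shift_monom i a) (of_nat (Poly_Mapping.lookup a i)))"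
  unfolding shift_der_monom_def
  by (rule sum.mono_neutral_left) (use assms in \<open>auto simp: in_keys_iff intro!: gr0I\<close>)

lemma shift_der_superset:
  assumes "finite K" "Poly_Mapping.keys f \<subseteq> K"
  shows "shift_der S f =
     (\<Sum>a\<in>K. Poly_Mapping.single 0 (Poly_Mapping.lookup f a) * shift_der_monom S a)"
  unfolding shift_der_def
  by (rule sum.mono_neutral_left) (use assms in \<open>auto simp: in_keys_iff\<close>)

lemma shift_der_zero: "shift_der S 0 = 0"
  by (simp add: shift_der_def)

lemma shift_der_add: "shift_der S (f + g) = shift_der S f + shift_der S g"
proof -
  let ?K = "Poly_Mapping.keys f \<union> Poly_Mapping.keys g"
  have "Poly_Mapping.keys (f + g) \<subseteq> ?K"
    by (rule Poly_Mapping.keys_add)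
  then show ?thesis
    by (simp add: shift_der_superset[of ?K] lookup_add single_add distrib_right sum.distrib)
qed

lemma shift_der_sum: "shift_der S (sum f A) = (\<Sum>x\<in>A. shift_der S (f x))"
  by (induction A rule: infinite_finite_induct) (simp_all add: shift_der_zero shift_der_add)

lemma shift_der_single:
  "shift_der S (Poly_Mapping.single a c) = Poly_Mapping.single 0 c * shift_der_monom S a"
  by (subst shift_der_superset[of "{a}"]) auto

text \<open>If \<open>i\<close> were absent from \<open>a\<close>, truncated subtraction would take
  the factor from \<open>b\<close> instead.\<close>

lemma shift_monom_add:
  assumes "i \<in> Poly_Mapping.keys a"
  shows "shift_monom i (a + b) = shift_monom i a + b"
  using assms
  by (intro poly_mapping_eqI)
    (auto simp: shift_monom_def lookup_add lookup_minus lookup_single in_keys_iff when_def)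

lemma single_shift_monom_add:
  "Poly_Mapping.single (shift_monom i (a + b)) (of_nat (Poly_Mapping.lookup (a + b) i)) =
     Poly_Mapping.single (shift_monom i a) (of_nat (Poly_Mapping.lookup a i))
       * Poly_Mapping.single b (1::'k::field)
     + Poly_Mapping.single a 1
       * Poly_Mapping.single (shift_monom i b) (of_nat (Poly_Mapping.lookup b i))"
proof -
  \<comment> \<open>If \<open>i\<close> does not occur in \<open>c\<close>, the monomials may
    differ, but both coefficients are zero.\<close>
  have "Poly_Mapping.single (shift_monom i (c + d)) (of_nat (Poly_Mapping.lookup c i) :: 'k) =
      Poly_Mapping.single (shift_monom i c + d) (of_nat (Poly_Mapping.lookup c i))" for c d
    by (cases "i \<in> Poly_Mapping.keys c") (simp_all add: shift_monom_add in_keys_iff)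
  from this[of a b] this[of b a] show ?thesis
    by (simp add: lookup_add single_add mult_single add.commute)
qed

lemma shift_der_monom_add:
  "shift_der_monom S (a + b) =
     shift_der_monom S a * Poly_Mapping.single b (1::'k::field)
     + Poly_Mapping.single a 1 * shift_der_monom S b"
proof -
  let ?K = "Poly_Mapping.keys a \<union> Poly_Mapping.keys b"
  have "Poly_Mapping.keys (a + b) \<subseteq> ?K"
    by (rule Poly_Mapping.keys_add)
  then show ?thesis
    by (simp add: shift_der_monom_superset[of ?K] single_shift_monom_add sum.distrib
        sum_distrib_left sum_distrib_right)
qed

lemma shift_der_mult_single:
  "shift_der S (Poly_Mapping.single a c * Poly_Mapping.single b d) =
     shift_der S (Poly_Mapping.single a c) * Poly_Mapping.single b d
     + Poly_Mapping.single a c * shift_der S (Poly_Mapping.single b d)"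
proof -
  \<comment> \<open>With the coefficients split off as constant factors,
    \<open>shift_der_monom_add\<close> and commutativity suffice.\<close>
  have scalar: "Poly_Mapping.single x e = Poly_Mapping.single 0 e * Poly_Mapping.single x 1"
    for x :: "nat \<Rightarrow>\<^sub>0 nat" and e :: 'a
    by (simp add: mult_single)
  have "Poly_Mapping.single 0 (c * d) =
      Poly_Mapping.single (0 :: nat \<Rightarrow>\<^sub>0 nat) c * Poly_Mapping.single 0 d"
    by (simp add: mult_single)
  then have "shift_der S (Poly_Mapping.single a c * Poly_Mapping.single b d) =
      Poly_Mapping.single 0 c * Poly_Mapping.single 0 d * shift_der_monom S (a + b)"
    by (simp add: mult_single[of a] shift_der_single)
  then show ?thesis
    unfolding shift_der_single shift_der_monom_add
    by (simp only: scalar[of a c] scalar[of b d] distrib_left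
        mult.assoc mult.commute mult.left_commute)
qed

lemma poly_mapping_eq_sum_single:
  "f = (\<Sum>a\<in>Poly_Mapping.keys f. Poly_Mapping.single a (Poly_Mapping.lookup f a))"
  by (intro poly_mapping_eqI)
    (auto simp: lookup_sum lookup_single when_def in_keys_iff)

lemma shift_der_mult: "shift_der S (f * g) = shift_der S f * g + f * shift_der S g"
proof -
  let ?s = "\<lambda>h a. Poly_Mapping.single a (Poly_Mapping.lookup h a)"
  let ?f = "\<Sum>a\<in>Poly_Mapping.keys f. ?s f a" and ?g = "\<Sum>a\<in>Poly_Mapping.keys g. ?s g a"
  \<comment> \<open>Both sides are biadditive, so the rule for products of single terms is
    enough.\<close>
  have "shift_der S (?f * ?g) = shift_der S ?f * ?g + ?f * shift_der S ?g"
    by (simp add: sum_product shift_der_sum shift_der_mult_single sum.distrib)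
  then show ?thesis
    by (simp flip: poly_mapping_eq_sum_single)
qed

lemma shift_der_in_derivations:
  "(shift_der S :: 'k::field inf_poly \<Rightarrow> 'k inf_poly) \<in> derivations inf_poly_scale"
proof -
  \<comment> \<open>Homogeneity comes from the Leibniz rule: the constant polynomial of
    \<open>c\<close> contains no variable and is killed.\<close>
  have "shift_der S (inf_poly_scale c f) = inf_poly_scale c (shift_der S f)"
    for c :: 'k and f
    by (simp add: inf_poly_scale_def shift_der_mult shift_der_single shift_der_monom_def)
  then show ?thesis
    by (simp add: derivations_def linear_iff vector_space_inf_poly_scale shift_der_add
        shift_der_mult)
qed

definition variable :: "nat \<Rightarrow> 'k::field inf_poly" where
  "variable i = Poly_Mapping.single (Poly_Mapping.single i 1) 1"

lemma shift_der_variable: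
  "shift_der S (variable i) = (if i \<in> S then variable (Suc i) else 0)"
  by (simp add: variable_def shift_der_single shift_der_monom_def shift_monom_def)

lemma variable_nonzero: "variable i \<noteq> 0"
  by (metis variable_def lookup_single_eq lookup_zero zero_neq_one)

section \<open>Weights of monomials and local nilpotence\<close>

definition monom_weight :: "(nat \<Rightarrow> nat) \<Rightarrow> (nat \<Rightarrow>\<^sub>0 nat) \<Rightarrow> nat" where
  "monom_weight w a = (\<Sum>i\<in>Poly_Mapping.keys a. Poly_Mapping.lookup a i * w i)"

lemma monom_weight_superset:
  assumes "finite K" "Poly_Mapping.keys a \<subseteq> K"
  shows "monom_weight w a = (\<Sum>i\<in>K. Poly_Mapping.lookup a i * w i)"
  unfolding monom_weight_def
  by (rule sum.mono_neutral_left) (use assms in \<open>auto simp: in_keys_iff\<close>)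

lemma monom_weight_add: "monom_weight w (a + b) = monom_weight w a + monom_weight w b"
proof -
  let ?K = "Poly_Mapping.keys a \<union> Poly_Mapping.keys b"
  have "Poly_Mapping.keys (a + b) \<subseteq> ?K"
    by (rule Poly_Mapping.keys_add)
  then show ?thesis
    by (simp add: monom_weight_superset[of ?K] lookup_add distrib_right sum.distrib)
qed

lemma monom_weight_single: "monom_weight w (Poly_Mapping.single i 1) = w i"
  by (simp add: monom_weight_def)

lemma monom_weight_shift_monom:
  assumes "i \<in> Poly_Mapping.keys a" "w (Suc i) < w i"
  shows "monom_weight w (shift_monom i a) < monom_weight w a"
proof -
  have "a = (a - Poly_Mapping.single i 1) + Poly_Mapping.single i 1"
    using assms(1)
    by (intro poly_mapping_eqI)
      (auto simp: lookup_add lookup_minus lookup_single in_keys_iff when_def)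
  then have "monom_weight w a = monom_weight w (a - Poly_Mapping.single i 1) + w i"
    by (metis monom_weight_add monom_weight_single)
  then show ?thesis
    using assms(2) by (simp only: shift_monom_def monom_weight_add monom_weight_single)
qed

text \<open>Expanding both sums bounds the support; cancellation or positive characteristic can only
  shrink it.\<close>

lemma keys_shift_der:
  assumes "b \<in> Poly_Mapping.keys (shift_der S f)"
  obtains a i where "a \<in> Poly_Mapping.keys f" "i \<in> Poly_Mapping.keys a" "i \<in> S"
    "b = shift_monom i a"
proof -
  let ?t = "\<lambda>a i. Poly_Mapping.single (shift_monom i a)
      (Poly_Mapping.lookup f a * of_nat (Poly_Mapping.lookup a i))"
  have "shift_der S f = (\<Sum>a\<in>Poly_Mapping.keys f. \<Sum>i\<in>Poly_Mapping.keys a \<inter> S. ?t a i)"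
    by (simp add: shift_der_def shift_der_monom_def sum_distrib_left mult_single)
  also have "Poly_Mapping.keys \<dots> \<subseteq>
      (\<Union>a\<in>Poly_Mapping.keys f. \<Union>i\<in>Poly_Mapping.keys a \<inter> S. Poly_Mapping.keys (?t a i))"
    by (intro order_trans[OF keys_sum] UN_mono order_refl keys_sum)
  finally obtain a i where "a \<in> Poly_Mapping.keys f" "i \<in> Poly_Mapping.keys a \<inter> S"
    "b \<in> Poly_Mapping.keys (?t a i)"
    using assms by blast
  with that show thesis
    by (auto split: if_splits)
qed

text \<open>One weight serves all sets of the family, so it drops at every step, in whatever order
  the derivations are applied.\<close>

lemma locally_nilpotent_shift_der:
  fixes \<S> :: "nat set set" and w :: "nat \<Rightarrow> nat"
  assumes "\<And>S i. S \<in> \<S> \<Longrightarrow> i \<in> S \<Longrightarrow> w (Suc i) < w i"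
  shows "locally_nilpotent (shift_der ` \<S> :: ('k::field inf_poly \<Rightarrow> 'k inf_poly) set)"
  unfolding locally_nilpotent_def
proof (intro allI impI)
  fix x :: "'k inf_poly" and F :: "nat \<Rightarrow> 'k inf_poly \<Rightarrow> 'k inf_poly"
  assume F: "\<forall>i. F i \<in> shift_der ` \<S>"
  have step: "\<exists>a\<in>Poly_Mapping.keys f. monom_weight w b < monom_weight w a"
    if "b \<in> Poly_Mapping.keys (F n f)" for n f b
  proof -
    obtain S where S: "S \<in> \<S>" "F n = shift_der S"
      using F by blast
    with that have "b \<in> Poly_Mapping.keys (shift_der S f)"
      by simp
    then obtain a i where "a \<in> Poly_Mapping.keys f" "i \<in> Poly_Mapping.keys a" "i \<in> S"
      "b = shift_monom i a"
      by (rule keys_shift_der)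
    then show ?thesis
      using monom_weight_shift_monom assms[OF S(1)] by blast
  qed
  \<comment> \<open>For \<open>x = 0\<close> this \<open>Max\<close> is unspecified, but then no
    composite has a monomial and the bound below is vacuous.\<close>
  define N where "N = Max (monom_weight w ` Poly_Mapping.keys x)"
  \<comment> \<open>The inequality is strict because \<open>comp_upto F n\<close> has
    \<open>n + 1\<close> factors; at \<open>n = N\<close> it excludes every monomial.\<close>
  have "monom_weight w b + n < N" if "b \<in> Poly_Mapping.keys (comp_upto F n x)" for n b
    using that
  proof (induction n arbitrary: b)
    case 0
    then obtain a where "a \<in> Poly_Mapping.keys x" "monom_weight w b < monom_weight w a"
      using step by force
    then show ?case
      unfolding N_def by (auto intro: less_le_trans)
  next
    case (Suc n)
    then show ?case
      using step[of b "Suc n" "comp_upto F n x"] by fastforce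
  qed
  then have "Poly_Mapping.keys (comp_upto F N x) = {}"
    by fastforce
  then have "comp_upto F N x = 0"
    by simp
  then show "\<exists>n. comp_upto F n x = 0" ..
qed

text \<open>As the sets cover all indices, the derivation applied to \<open>variable i\<close> can
  always be chosen to move it on.\<close>

lemma not_locally_nilpotent_shift_der:
  assumes "\<And>i. \<exists>S\<in>\<S>. i \<in> S"
  shows "\<not> locally_nilpotent (shift_der ` \<S> :: ('k::field inf_poly \<Rightarrow> 'k inf_poly) set)"
proof
  assume nil: "locally_nilpotent (shift_der ` \<S> :: ('k inf_poly \<Rightarrow> 'k inf_poly) set)"
  obtain S where S: "S i \<in> \<S>" "i \<in> S i" for i
    using assms by metis
  have "comp_upto (\<lambda>i. shift_der (S i)) n (variable 0 :: 'k inf_poly) = variable (Suc n)" for n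
    by (induction n) (simp_all add: shift_der_variable S)
  moreover obtain n where "comp_upto (\<lambda>i. shift_der (S i)) n (variable 0 :: 'k inf_poly) = 0"
    using nil[unfolded locally_nilpotent_def, rule_format, of "\<lambda>i. shift_der (S i)" "variable 0"]
      S(1) by auto
  ultimately show False
    by (metis variable_nonzero)
qed

text \<open>\<open>S\<close> is recovered as the set of variables not killed. Hence counting
  derivations amounts to counting sets.\<close>

lemma inj_shift_der: "inj (shift_der :: nat set \<Rightarrow> 'k::field inf_poly \<Rightarrow> 'k inf_poly)"
proof (rule injI)
  fix S T assume eq: "shift_der S = (shift_der T :: 'k inf_poly \<Rightarrow> 'k inf_poly)"
  have mem: "i \<in> S \<longleftrightarrow> shift_der S (variable i :: 'k inf_poly) \<noteq> 0" for S i
    by (simp add: shift_der_variable variable_nonzero)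
  show "S = T"
    by (rule set_eqI) (simp only: mem eq)
qed

section \<open>Residue classes and the two families\<close>

definition cyclic_distance :: "nat \<Rightarrow> nat \<Rightarrow> nat \<Rightarrow> nat" where
  "cyclic_distance m j i = (if i mod m \<le> j then j - i mod m else m + j - i mod m)"

text \<open>For \<open>j < m\<close> the distance is the residue of \<open>j - i\<close> modulo
  \<open>m\<close>: it falls by one at each step, except that it jumps from \<open>0\<close> to
  \<open>m - 1\<close> on leaving the class of \<open>j\<close>.\<close>

lemma cyclic_distance_Suc_less:
  assumes "j < m" "i mod m \<noteq> j"
  shows "cyclic_distance m j (Suc i) < cyclic_distance m j i"
proof -
  have "i mod m < m"
    using assms(1) by simp
  \<comment> \<open>The first case is the wraparound, where the distance goes from
    \<open>j + 1\<close> to \<open>j\<close>.\<close>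
  with assms consider "Suc (i mod m) = m" "j < i mod m" | "i mod m < j"
    | "j < i mod m" "Suc (i mod m) < m"
    by linarith
  then show ?thesis
    by cases (use assms(1) in \<open>auto simp: cyclic_distance_def mod_Suc\<close>)
qed

theorem corollary5p7:
  "(\<exists>\<Delta> \<subseteq> derivations (inf_poly_scale :: 'k::field \<Rightarrow> 'k inf_poly \<Rightarrow> 'k inf_poly).
       infinite \<Delta> \<and> \<not> locally_nilpotent \<Delta> \<and>
       (\<forall>\<Gamma> \<subseteq> \<Delta>. finite \<Gamma> \<longrightarrow> locally_nilpotent \<Gamma>)) \<and>
   (\<forall>m::nat. m \<ge> 2 \<longrightarrow>
     (\<exists>\<Delta> \<subseteq> derivations (inf_poly_scale :: 'k \<Rightarrow> 'k inf_poly \<Rightarrow> 'k inf_poly).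
       finite \<Delta> \<and> card \<Delta> = m \<and> \<not> locally_nilpotent \<Delta> \<and>
       (\<forall>\<Gamma> \<subset> \<Delta>. locally_nilpotent \<Gamma>)))"
proof (intro conjI allI impI)
  let ?D = "shift_der :: nat set \<Rightarrow> 'k inf_poly \<Rightarrow> 'k inf_poly"
  let ?S = "range (\<lambda>n::nat. {n})"
  have "locally_nilpotent \<Gamma>" if \<Gamma>: "\<Gamma> \<subseteq> ?D ` ?S" "finite \<Gamma>" for \<Gamma>
  proof -
    obtain A where A: "finite A" "\<Gamma> = ?D ` (\<lambda>n. {n}) ` A"
      using finite_subset_image[OF \<Gamma>(2), of "\<lambda>n. ?D {n}" UNIV] \<Gamma>(1)
      by (auto simp: image_image)
    \<comment> \<open>The outer \<open>Suc\<close> keeps the weight positive at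
      \<open>i = Max A\<close>, so that it can still drop; for empty \<open>A\<close> the claim is
      vacuous.\<close>
    then have "Suc (Max A) - Suc i < Suc (Max A) - i" if "i \<in> A" for i
      using that by (simp add: Suc_diff_le)
    then show ?thesis
      unfolding A(2) by (intro locally_nilpotent_shift_der[of _ "\<lambda>i. Suc (Max A) - i"]) auto
  qed
  moreover have "infinite (?D ` ?S)"
    by (simp add: finite_image_iff inj_on_subset[OF inj_shift_der])
  moreover have "\<not> locally_nilpotent (?D ` ?S)"
    by (intro not_locally_nilpotent_shift_der) auto
  moreover have "?D ` ?S \<subseteq> derivations inf_poly_scale"
    using shift_der_in_derivations by blast
  ultimately show "\<exists>\<Delta> \<subseteq> derivations (inf_poly_scale :: 'k \<Rightarrow> 'k inf_poly \<Rightarrow> 'k inf_poly).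
       infinite \<Delta> \<and> \<not> locally_nilpotent \<Delta> \<and>
       (\<forall>\<Gamma> \<subseteq> \<Delta>. finite \<Gamma> \<longrightarrow> locally_nilpotent \<Gamma>)"
    by blast
next
  fix m :: nat assume "m \<ge> 2"
  let ?D = "shift_der :: nat set \<Rightarrow> 'k inf_poly \<Rightarrow> 'k inf_poly"
  let ?C = "\<lambda>j. {i. i mod m = j}"
  let ?S = "?C ` {..<m}"
  have "locally_nilpotent \<Gamma>" if \<Gamma>: "\<Gamma> \<subset> ?D ` ?S" for \<Gamma>
  proof -
    from \<Gamma> obtain j where j: "j < m" "?D (?C j) \<notin> \<Gamma>"
      by blast
    from \<Gamma> obtain \<S> where \<S>: "\<S> \<subseteq> ?S" "\<Gamma> = ?D ` \<S>"
      by (meson psubset_imp_subset subset_imageE)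
    \<comment> \<open>A residue class containing an index of residue \<open>j\<close> is
      \<open>?C j\<close> itself, whose derivation is missing from the subset.\<close>
    have "i mod m \<noteq> j" if "S \<in> \<S>" "i \<in> S" for S i
      using \<S> j(2) that by blast
    then show ?thesis
      unfolding \<S>(2)
      by (intro locally_nilpotent_shift_der[of _ "cyclic_distance m j"]
          cyclic_distance_Suc_less j(1))
  qed
  \<comment> \<open>For \<open>j < m\<close> the class \<open>?C j\<close> contains
    \<open>j\<close>, which determines it.\<close>
  moreover have "inj_on ?C {..<m}"
    by (rule inj_onI) (metis (mono_tags, lifting) lessThan_iff mem_Collect_eq mod_less)
  then have "card (?D ` ?S) = m"
    by (simp add: card_image inj_on_subset[OF inj_shift_der])
  moreover have "\<not> locally_nilpotent (?D ` ?S)"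
    \<comment> \<open>Positivity of \<open>m\<close> puts every residue \<open>i mod m\<close> below
      \<open>m\<close>, so the classes cover all indices.\<close>
    using \<open>m \<ge> 2\<close> by (intro not_locally_nilpotent_shift_der) auto
  moreover have "?D ` ?S \<subseteq> derivations inf_poly_scale"
    using shift_der_in_derivations by blast
  ultimately show "\<exists>\<Delta> \<subseteq> derivations (inf_poly_scale :: 'k \<Rightarrow> 'k inf_poly \<Rightarrow> 'k inf_poly).
       finite \<Delta> \<and> card \<Delta> = m \<and> \<not> locally_nilpotent \<Delta> \<and> (\<forall>\<Gamma> \<subset> \<Delta>. locally_nilpotent \<Gamma>)"
    by blast
qed

end
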